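(* Let $X$ be a Banach space, let $\alpha$ be a cross-norm on $X\odot X$, and let $\{x_k\}_{k\ge1}$ be a bounded sequence in $X$ such that the sequence $\{x_k\otimes x_k\}$ is ergodic in $X\otimes_\alpha X$. Then $\{x_k\}$ is uniformly weakly mixing to zero.
   Context: For a Banach space $Z$, $Z^*$ is its dual and $B_Z=\{z\in Z:\|z\|\le 1\}$. $X\odot X$ is the algebraic tensor product; $X\otimes_\alpha X$ is its completion with respect to the cross-norm $\alpha$ (i.e. $\alpha(x\otimes y)=\|x\|\|y\|$). It is part of the setting that the conjugate (dual) norm $\alpha^*(\varphi)=\sup\{|\varphi(u)|:u\in X\odot X,\ \alpha(u)\le1\}$ on $X^*\odot X^*$ is a (finite) cross-norm, where $(f\otimes g)(x\otimes y)=f(x)g(y)$. A sequence $\{z_k\}_{k\ge1}$ in a Banach space $Z$ is ergodic if $\lim_{n\to\infty}\frac1n\|\sum_{k=1}^n z_k\|=0$; it is uniformly weakly mixing to zero if $\lim_{n\to\infty}\sup\{\frac1n\sum_{k=1}^n|f(z_k)|: f\in B_{Z^*}\}=0$.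
   Formalization: X is taken to be a real Banach space (real dual and real tensor product); over complex scalars the claim fails, e.g. X = C, x_k = i^k: x_k⊗x_k = (-1)^k is ergodic, but |x_k| = 1 for all k. *)

theory Defs
  imports "HOL-Analysis.Analysis" "HOL-Analysis.Finite_Function_Topology"
begin

section \<open>Free real vector spaces\<close>

lemma lookup_scaleR:
  "Poly_Mapping.lookup (c *\<^sub>R f) k = c *\<^sub>R Poly_Mapping.lookup f k"
  for f :: "'a \<Rightarrow>\<^sub>0 'v::real_vector"
proof -
  have "finite {k. c *\<^sub>R Poly_Mapping.lookup f k \<noteq> 0}"
    by (rule finite_subset[OF _ finite_lookup[of f]]) auto
  then show ?thesis
    by (simp add: scaleR_poly_mapping_def)
qed

definition free_extend :: "('a \<Rightarrow> 'v::real_vector) \<Rightarrow> ('a \<Rightarrow>\<^sub>0 real) \<Rightarrow> 'v"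
  where "free_extend h f = (\<Sum>k\<in>Poly_Mapping.keys f. Poly_Mapping.lookup f k *\<^sub>R h k)"

lemma free_extend_superset:
  assumes "finite K" "Poly_Mapping.keys f \<subseteq> K"
  shows "free_extend h f = (\<Sum>k\<in>K. Poly_Mapping.lookup f k *\<^sub>R h k)"
  unfolding free_extend_def
  by (rule sum.mono_neutral_left) (use assms in \<open>auto simp: in_keys_iff\<close>)

lemma linear_free_extend: "linear (free_extend h)"
proof (rule linearI)
  fix f g :: "'a \<Rightarrow>\<^sub>0 real"
  let ?K = "Poly_Mapping.keys f \<union> Poly_Mapping.keys g"
  have "free_extend h (f + g) = (\<Sum>k\<in>?K. Poly_Mapping.lookup (f + g) k *\<^sub>R h k)"
    by (rule free_extend_superset) (simp_all add: Poly_Mapping.keys_add)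
  also have "\<dots> = (\<Sum>k\<in>?K. Poly_Mapping.lookup f k *\<^sub>R h k) +
      (\<Sum>k\<in>?K. Poly_Mapping.lookup g k *\<^sub>R h k)"
    by (simp add: lookup_add scaleR_add_left sum.distrib)
  also have "\<dots> = free_extend h f + free_extend h g"
    using free_extend_superset[of ?K f h] free_extend_superset[of ?K g h] by simp
  finally show "free_extend h (f + g) = free_extend h f + free_extend h g" .
next
  fix c :: real and f :: "'a \<Rightarrow>\<^sub>0 real"
  have "free_extend h (c *\<^sub>R f) =
      (\<Sum>k\<in>Poly_Mapping.keys f. Poly_Mapping.lookup (c *\<^sub>R f) k *\<^sub>R h k)"
    by (rule free_extend_superset) (auto simp: in_keys_iff lookup_scaleR)
  then show "free_extend h (c *\<^sub>R f) = c *\<^sub>R free_extend h f"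
    by (simp add: free_extend_def lookup_scaleR scaleR_sum_right)
qed

lemma free_extend_single [simp]: "free_extend h (Poly_Mapping.single k c) = c *\<^sub>R h k"
  by (simp add: free_extend_def)

lemma span_singles: "span (range (\<lambda>k. Poly_Mapping.single k (1::real))) = UNIV"
proof -
  have "f \<in> span (range (\<lambda>k. Poly_Mapping.single k 1))" for f :: "'a \<Rightarrow>\<^sub>0 real"
  proof -
    have "f = (\<Sum>k\<in>Poly_Mapping.keys f. Poly_Mapping.lookup f k *\<^sub>R Poly_Mapping.single k 1)"
    proof (rule poly_mapping_eqI)
      fix j
      have "Poly_Mapping.lookup
          (\<Sum>k\<in>Poly_Mapping.keys f. Poly_Mapping.lookup f k *\<^sub>R Poly_Mapping.single k 1) j =
          (\<Sum>k\<in>Poly_Mapping.keys f. if k = j then Poly_Mapping.lookup f k else 0)"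
        unfolding lookup_sum
        by (rule sum.cong) (auto simp: lookup_scaleR lookup_single)
      then show "Poly_Mapping.lookup f j = Poly_Mapping.lookup
          (\<Sum>k\<in>Poly_Mapping.keys f. Poly_Mapping.lookup f k *\<^sub>R Poly_Mapping.single k 1) j"
        by (simp add: in_keys_iff)
    qed
    also have "\<dots> \<in> span (range (\<lambda>k. Poly_Mapping.single k 1))"
      by (rule span_sum, rule span_scale, rule span_base, rule rangeI)
    finally show ?thesis .
  qed
  then show ?thesis by blast
qed


section \<open>The algebraic tensor product\<close>

definition tensor_relations :: "('a::real_vector \<times> 'b::real_vector \<Rightarrow>\<^sub>0 real) set"
  where "tensor_relations =
    {Poly_Mapping.single (x + x', y) 1 - Poly_Mapping.single (x, y) 1 - Poly_Mapping.single (x', y) 1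
      | x x' y. True} \<union>
    {Poly_Mapping.single (x, y + y') 1 - Poly_Mapping.single (x, y) 1 - Poly_Mapping.single (x, y') 1
      | x y y'. True} \<union>
    {Poly_Mapping.single (c *\<^sub>R x, y) 1 - c *\<^sub>R Poly_Mapping.single (x, y) 1 | c x y. True} \<union>
    {Poly_Mapping.single (x, c *\<^sub>R y) 1 - c *\<^sub>R Poly_Mapping.single (x, y) 1 | c x y. True}"

lemma span_trans_diff: "f - h \<in> span S" if "f - g \<in> span S" "g - h \<in> span S"
  for f g h :: "'v::real_vector"
  using span_add[OF that] by simp

quotient_type (overloaded) ('a, 'b) tensor =
  "('a::real_vector \<times> 'b::real_vector \<Rightarrow>\<^sub>0 real)" / "\<lambda>f g. f - g \<in> span tensor_relations"
proof (rule equivpI)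
  show "reflp (\<lambda>f g. f - g \<in> span tensor_relations)"
    by (rule reflpI) (simp add: span_zero)
  show "symp (\<lambda>f g. f - g \<in> span tensor_relations)"
    by (rule sympI) (metis minus_diff_eq span_neg)
  show "transp (\<lambda>f g. f - g \<in> span tensor_relations)"
    by (rule transpI) (use span_trans_diff in blast)
qed

instantiation tensor :: (real_vector, real_vector) real_vector
begin

lift_definition zero_tensor :: "('a, 'b) tensor" is 0 .

lift_definition plus_tensor :: "('a, 'b) tensor \<Rightarrow> ('a, 'b) tensor \<Rightarrow> ('a, 'b) tensor" is "(+)"
  subgoal for f f' g g'
    using span_add[of "f - f'" tensor_relations "g - g'"] by (simp add: algebra_simps)
  done

lift_definition minus_tensor :: "('a, 'b) tensor \<Rightarrow> ('a, 'b) tensor \<Rightarrow> ('a, 'b) tensor" is "(-)"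
  subgoal for f f' g g'
    using span_diff[of "f - f'" tensor_relations "g - g'"] by (simp add: algebra_simps)
  done

lift_definition uminus_tensor :: "('a, 'b) tensor \<Rightarrow> ('a, 'b) tensor" is "uminus"
  subgoal for f f'
    using span_neg[of "f - f'" tensor_relations] by simp
  done

lift_definition scaleR_tensor :: "real \<Rightarrow> ('a, 'b) tensor \<Rightarrow> ('a, 'b) tensor" is "(*\<^sub>R)"
  subgoal for c f f'
    using span_scale[of "f - f'" tensor_relations c] by (simp add: scaleR_diff_right)
  done

instance
  by standard (transfer, simp add: algebra_simps span_zero)+

end

lift_definition tensor :: "'a::real_vector \<Rightarrow> 'b::real_vector \<Rightarrow> ('a, 'b) tensor" (infixl "\<otimes>" 75)
  is "\<lambda>x y. Poly_Mapping.single (x, y) 1" .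

lemma tensor_add_left: "(x + x') \<otimes> y = x \<otimes> y + x' \<otimes> y"
  by transfer (rule span_base, unfold tensor_relations_def diff_diff_eq[symmetric], blast)

lemma tensor_add_right: "x \<otimes> (y + y') = x \<otimes> y + x \<otimes> y'"
  by transfer (rule span_base, unfold tensor_relations_def diff_diff_eq[symmetric], blast)

lemma tensor_scaleR_left: "(c *\<^sub>R x) \<otimes> y = c *\<^sub>R (x \<otimes> y)"
  by transfer (rule span_base, unfold tensor_relations_def, blast)

lemma tensor_scaleR_right: "x \<otimes> (c *\<^sub>R y) = c *\<^sub>R (x \<otimes> y)"
  by transfer (rule span_base, unfold tensor_relations_def, blast)

lemma bilinear_tensor: "bilinear (\<otimes>)"
  unfolding bilinear_def
  by (simp add: linear_iff tensor_add_left tensor_add_right tensor_scaleR_left tensor_scaleR_right)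

lemma linear_abs_tensor: "linear abs_tensor"
  by (rule linearI) (simp_all add: plus_tensor.abs_eq scaleR_tensor.abs_eq)

lemma span_elementary_tensors:
  "span (range (\<lambda>(x, y). x \<otimes> y)) = (UNIV :: ('a::real_vector, 'b::real_vector) tensor set)"
proof -
  have "surj (abs_tensor :: ('a \<times> 'b \<Rightarrow>\<^sub>0 real) \<Rightarrow> ('a, 'b) tensor)"
    by (rule surjI[of _ rep_tensor]) (rule Quotient3_abs_rep[OF Quotient3_tensor])
  then have "(UNIV :: ('a, 'b) tensor set) = abs_tensor ` span (range (\<lambda>k. Poly_Mapping.single k 1))"
    by (simp only: span_singles)
  also have "\<dots> = span (abs_tensor ` range (\<lambda>k. Poly_Mapping.single k 1))"
    by (rule linear_span_image[OF linear_abs_tensor, symmetric])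
  also have "abs_tensor ` range (\<lambda>k. Poly_Mapping.single k 1) = range (\<lambda>(x, y). x \<otimes> y)"
    by (simp add: image_image tensor.abs_eq case_prod_unfold)
  finally show ?thesis by simp
qed

lemma linear_eq_tensorI:
  fixes L M :: "('a::real_vector, 'b::real_vector) tensor \<Rightarrow> 'v::real_vector"
  assumes "linear L" "linear M" "\<And>x y. L (x \<otimes> y) = M (x \<otimes> y)"
  shows "L u = M u"
proof -
  have "u \<in> span (range (\<lambda>(x, y). x \<otimes> y))" by (simp add: span_elementary_tensors)
  then show ?thesis by (rule linear_eq_on_span[OF assms(1,2), rotated]) (use assms(3) in auto)
qed

text \<open>The linear map induced by a bilinear map; unspecified when \<open>B\<close> is not bilinear.\<close>

definition tensor_lift ::
    "('a::real_vector \<Rightarrow> 'b::real_vector \<Rightarrow> 'v::real_vector) \<Rightarrow> ('a, 'b) tensor \<Rightarrow> 'v"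
  where "tensor_lift B = (THE L. linear L \<and> (\<forall>x y. L (x \<otimes> y) = B x y))"

lemma tensor_universal:
  fixes B :: "'a::real_vector \<Rightarrow> 'b::real_vector \<Rightarrow> 'v::real_vector"
  assumes B: "bilinear B"
  shows "\<exists>!L. linear L \<and> (\<forall>x y. L (x \<otimes> y) = B x y)"
proof (rule ex_ex1I)
  define E where "E = free_extend (\<lambda>(x, y). B x y)"
  have E: "linear E" unfolding E_def by (rule linear_free_extend)
  have vanish: "E r = 0" if "r \<in> span tensor_relations" for r
  proof -
    have "E s = 0" if "s \<in> tensor_relations" for s
      using that unfolding tensor_relations_def
      by (auto simp: E_def linear_diff[OF linear_free_extend] linear_scale[OF linear_free_extend]
          bilinear_ladd[OF B] bilinear_radd[OF B] bilinear_lmul[OF B] bilinear_rmul[OF B])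
    then show ?thesis using linear_eq_0_on_span[OF E _ that] by blast
  qed
  define L where "L u = E (rep_tensor u)" for u
  have L_abs: "L (abs_tensor f) = E f" for f
  proof -
    have "rep_tensor (abs_tensor f) - f \<in> span tensor_relations"
      by (rule Quotient3_rep_abs[OF Quotient3_tensor]) (simp add: span_zero)
    from vanish[OF this] show ?thesis by (simp add: L_def linear_diff[OF E])
  qed
  have "linear L"
  proof (rule linearI)
    show "L (u + v) = L u + L v" for u v
      by (induction u; induction v) (simp add: plus_tensor.abs_eq L_abs linear_add[OF E])
    show "L (c *\<^sub>R u) = c *\<^sub>R L u" for c u
      by (induction u) (simp add: scaleR_tensor.abs_eq L_abs linear_scale[OF E])
  qed
  moreover have "L (x \<otimes> y) = B x y" for x y
    by (simp add: tensor.abs_eq L_abs E_def)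
  ultimately show "\<exists>L. linear L \<and> (\<forall>x y. L (x \<otimes> y) = B x y)" by blast
next
  fix L M :: "('a, 'b) tensor \<Rightarrow> 'v"
  assume L: "linear L \<and> (\<forall>x y. L (x \<otimes> y) = B x y)" and M: "linear M \<and> (\<forall>x y. M (x \<otimes> y) = B x y)"
  then have "L u = M u" for u
    by (intro linear_eq_tensorI[of L M u]) auto
  then show "L = M" ..
qed

lemma
  assumes "bilinear B"
  shows linear_tensor_lift: "linear (tensor_lift B)"
    and tensor_lift_tensor: "tensor_lift B (x \<otimes> y) = B x y"
  using theI'[OF tensor_universal[OF assms]] unfolding tensor_lift_def by auto


section \<open>Cross-norms, the conjugate norm and completions\<close>

definition is_norm :: "('v::real_vector \<Rightarrow> real) \<Rightarrow> bool"
  where "is_norm N \<longleftrightarrow>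
    (\<forall>u. N u = 0 \<longleftrightarrow> u = 0) \<and>
    (\<forall>u v. N (u + v) \<le> N u + N v) \<and>
    (\<forall>c u. N (c *\<^sub>R u) = \<bar>c\<bar> * N u)"

definition cross_norm ::
    "(('a::real_normed_vector, 'b::real_normed_vector) tensor \<Rightarrow> real) \<Rightarrow> bool"
  where "cross_norm \<alpha> \<longleftrightarrow> is_norm \<alpha> \<and> (\<forall>x y. \<alpha> (x \<otimes> y) = norm x * norm y)"

definition tensor_pairing ::
    "('a::real_normed_vector \<Rightarrow>\<^sub>L real, 'b::real_normed_vector \<Rightarrow>\<^sub>L real) tensor \<Rightarrow>
      ('a, 'b) tensor \<Rightarrow> real"
  where "tensor_pairing \<phi> u =
    tensor_lift (\<lambda>f g. tensor_lift (\<lambda>x y. blinfun_apply f x * blinfun_apply g y) u) \<phi>"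

lemma bilinear_blinfun_mult:
  fixes f :: "'a::real_normed_vector \<Rightarrow>\<^sub>L real" and g :: "'b::real_normed_vector \<Rightarrow>\<^sub>L real"
  shows "bilinear (\<lambda>x y. blinfun_apply f x * blinfun_apply g y)"
  unfolding bilinear_def by (simp add: linear_iff blinfun.bilinear_simps algebra_simps)

lemma bilinear_tensor_lift_blinfun:
  fixes u :: "('a::real_normed_vector, 'b::real_normed_vector) tensor"
  shows "bilinear (\<lambda>(f :: 'a \<Rightarrow>\<^sub>L real) (g :: 'b \<Rightarrow>\<^sub>L real).
    tensor_lift (\<lambda>x y. blinfun_apply f x * blinfun_apply g y) u)"
proof -
  let ?T = "\<lambda>(f :: 'a \<Rightarrow>\<^sub>L real) (g :: 'b \<Rightarrow>\<^sub>L real).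
    tensor_lift (\<lambda>x y. blinfun_apply f x * blinfun_apply g y)"
  have T: "linear (?T f g)" and T_tensor: "?T f g (x \<otimes> y) = blinfun_apply f x * blinfun_apply g y"
    for f g x y
    by (rule linear_tensor_lift tensor_lift_tensor, rule bilinear_blinfun_mult)+
  have "?T (f + f') g u = ?T f g u + ?T f' g u" for f f' g
    by (rule linear_eq_tensorI[OF T linear_compose_add[OF T T]], unfold T_tensor)
      (simp add: blinfun.bilinear_simps algebra_simps)
  moreover have "?T f (g + g') u = ?T f g u + ?T f g' u" for f g g'
    by (rule linear_eq_tensorI[OF T linear_compose_add[OF T T]], unfold T_tensor)
      (simp add: blinfun.bilinear_simps algebra_simps)
  moreover have "?T (c *\<^sub>R f) g u = c *\<^sub>R ?T f g u" for c f g
    by (rule linear_eq_tensorI[OF T linear_compose_scale_right[OF T]], unfold T_tensor)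
      (simp add: blinfun.bilinear_simps algebra_simps)
  moreover have "?T f (c *\<^sub>R g) u = c *\<^sub>R ?T f g u" for c f g
    by (rule linear_eq_tensorI[OF T linear_compose_scale_right[OF T]], unfold T_tensor)
      (simp add: blinfun.bilinear_simps algebra_simps)
  ultimately show ?thesis
    unfolding bilinear_def by (simp add: linear_iff)
qed

lemma tensor_pairing_tensor:
  "tensor_pairing (f \<otimes> g) (x \<otimes> y) = blinfun_apply f x * blinfun_apply g y"
  unfolding tensor_pairing_def tensor_lift_tensor[OF bilinear_tensor_lift_blinfun]
  by (rule tensor_lift_tensor[OF bilinear_blinfun_mult])

lemma linear_tensor_pairing_left: "linear (\<lambda>\<phi>. tensor_pairing \<phi> u)"
  unfolding tensor_pairing_def by (rule linear_tensor_lift[OF bilinear_tensor_lift_blinfun])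

lemma linear_tensor_pairing_right: "linear (tensor_pairing \<phi>)"
proof -
  have lin_sum: "linear (tensor_pairing (\<phi> + \<psi>))"
    if "linear (tensor_pairing \<phi>)" "linear (tensor_pairing \<psi>)" for \<phi> \<psi>
    using that by (simp add: linear_iff linear_add[OF linear_tensor_pairing_left] algebra_simps)
  have lin_scale: "linear (tensor_pairing (c *\<^sub>R \<phi>))" if "linear (tensor_pairing \<phi>)" for c \<phi>
    using that by (simp add: linear_iff linear_scale[OF linear_tensor_pairing_left] algebra_simps)
  have lin_zero: "linear (tensor_pairing 0)"
    by (simp add: linear_iff linear_0[OF linear_tensor_pairing_left])
  have lin_tensor: "linear (tensor_pairing (f \<otimes> g))" for f g
  proof -
    have "tensor_pairing (f \<otimes> g) = tensor_lift (\<lambda>x y. blinfun_apply f x * blinfun_apply g y)"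
      by (simp add: fun_eq_iff tensor_pairing_def tensor_lift_tensor bilinear_tensor_lift_blinfun)
    then show ?thesis by (simp add: linear_tensor_lift bilinear_blinfun_mult)
  qed
  have "\<phi> \<in> span (range (\<lambda>(f, g). f \<otimes> g))" by (simp add: span_elementary_tensors)
  then show ?thesis
    by (induction rule: span_induct_alt) (auto intro: lin_sum lin_scale lin_zero lin_tensor)
qed

text \<open>The supremum is meaningful only if the set below is bounded above, which has to be
  required separately (\<open>conj_norm_finite\<close>).\<close>

definition conj_norm ::
    "(('a::real_normed_vector, 'b::real_normed_vector) tensor \<Rightarrow> real) \<Rightarrow>
      ('a \<Rightarrow>\<^sub>L real, 'b \<Rightarrow>\<^sub>L real) tensor \<Rightarrow> real"
  where "conj_norm \<alpha> \<phi> = (SUP u\<in>{u. \<alpha> u \<le> 1}. \<bar>tensor_pairing \<phi> u\<bar>)"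

definition conj_norm_finite ::
    "(('a::real_normed_vector, 'b::real_normed_vector) tensor \<Rightarrow> real) \<Rightarrow> bool"
  where "conj_norm_finite \<alpha> \<longleftrightarrow>
    (\<forall>\<phi>. bdd_above ((\<lambda>u. \<bar>tensor_pairing \<phi> u\<bar>) ` {u. \<alpha> u \<le> 1}))"

text \<open>A completion of \<open>(V, N)\<close> is a Banach space containing an isometric copy of it as a dense
  subspace. A type cannot depend on the term \<open>N\<close>, so the completion is not constructed as a type;
  it is unique up to isometric isomorphism and represented by the embedding \<open>\<iota>\<close>.\<close>

definition is_completion :: "('v::real_vector \<Rightarrow> real) \<Rightarrow> ('v \<Rightarrow> 'c::banach) \<Rightarrow> bool"
  where "is_completion N \<iota> \<longleftrightarrow>
    linear \<iota> \<and> (\<forall>u. norm (\<iota> u) = N u) \<and> closure (range \<iota>) = UNIV"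


section \<open>Ergodic and uniformly weakly mixing sequences\<close>

text \<open>Sequences are indexed by \<open>k \<ge> 1\<close>: the value at \<open>0\<close> is irrelevant.\<close>

definition ergodic :: "(nat \<Rightarrow> 'z::real_normed_vector) \<Rightarrow> bool"
  where "ergodic z \<longleftrightarrow> (\<lambda>n. (1 / real n) * norm (\<Sum>k=1..n. z k)) \<longlonglongrightarrow> 0"

definition uniformly_weakly_mixing_to_zero :: "(nat \<Rightarrow> 'z::real_normed_vector) \<Rightarrow> bool"
  where "uniformly_weakly_mixing_to_zero z \<longleftrightarrow>
    (\<lambda>n. SUP f\<in>cball (0 :: 'z \<Rightarrow>\<^sub>L real) 1. (1 / real n) * (\<Sum>k=1..n. \<bar>blinfun_apply f (z k)\<bar>))
      \<longlonglongrightarrow> 0"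

end

theory Submission
  imports Defs
begin

text \<open>For \<open>f\<close> in the dual unit ball, \<open>\<Sum>k\<le>n. (f (x k))\<^sup>2\<close> is the value of \<open>f \<otimes> f\<close> at
  \<open>u n = (\<Sum>k\<le>n. x k \<otimes> x k)\<close>, hence at most \<open>\<alpha> (u n)\<close> because the conjugate norm of \<open>f \<otimes> f\<close> is
  at most 1. By Cauchy--Schwarz, the mean of \<open>\<bar>f (x k)\<bar>\<close> over \<open>k \<le> n\<close> is bounded by
  \<open>sqrt (\<alpha> (u n) / n)\<close>, uniformly in \<open>f\<close>.\<close>

text \<open>Rescaling a nonzero \<open>u\<close> to \<alpha>-norm 1 puts it into the set over which
  \<open>conj_norm\<close> takes its supremum; linearity of the pairing scales back. Finiteness is
  what makes the real-valued \<open>SUP\<close> an upper bound.\<close>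

lemma tensor_pairing_le_conj_norm:
  assumes norm: "is_norm \<alpha>" and fin: "conj_norm_finite \<alpha>"
  shows "\<bar>tensor_pairing \<phi> u\<bar> \<le> conj_norm \<alpha> \<phi> * \<alpha> u"
proof (cases "u = 0")
  case True
  moreover have "\<alpha> 0 = 0"
    using norm unfolding is_norm_def by blast
  ultimately show ?thesis
    by (simp add: linear_0[OF linear_tensor_pairing_right])
next
  case False
  have scale: "\<alpha> (c *\<^sub>R v) = \<bar>c\<bar> * \<alpha> v" for c v
    using norm by (simp add: is_norm_def)
  \<comment> \<open>Positivity is not a clause of \<open>is_norm\<close>: it comes from
    \<open>0 = \<alpha> (u - u) \<le> 2 * \<alpha> u\<close> and
    \<open>\<alpha> u \<noteq> 0\<close>.\<close>
  have "\<alpha> (u + (- 1) *\<^sub>R u) \<le> \<alpha> u + \<alpha> ((- 1) *\<^sub>R u)" "\<alpha> 0 = 0" "\<alpha> u \<noteq> 0"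
    using norm False unfolding is_norm_def by blast+
  then have pos: "\<alpha> u > 0"
    unfolding scale by simp
  have "\<bar>tensor_pairing \<phi> (inverse (\<alpha> u) *\<^sub>R u)\<bar> \<le> conj_norm \<alpha> \<phi>"
    unfolding conj_norm_def
  proof (rule cSUP_upper)
    show "inverse (\<alpha> u) *\<^sub>R u \<in> {u. \<alpha> u \<le> 1}"
      using pos by (simp add: scale)
    show "bdd_above ((\<lambda>u. \<bar>tensor_pairing \<phi> u\<bar>) ` {u. \<alpha> u \<le> 1})"
      using fin by (simp add: conj_norm_finite_def)
  qed
  with pos show ?thesis
    by (simp add: linear_scale[OF linear_tensor_pairing_right] abs_mult field_simps)
qed

lemma sum_power2_le_cross_norm:
  fixes \<alpha> :: "('a::real_normed_vector, 'a) tensor \<Rightarrow> real" and f :: "'a \<Rightarrow>\<^sub>L real"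
  assumes "is_norm \<alpha>" and "conj_norm_finite \<alpha>" and "cross_norm (conj_norm \<alpha>)"
  shows "(\<Sum>k\<in>A. (blinfun_apply f (x k))\<^sup>2) \<le> (norm f)\<^sup>2 * \<alpha> (\<Sum>k\<in>A. x k \<otimes> x k)"
proof -
  have "(\<Sum>k\<in>A. (blinfun_apply f (x k))\<^sup>2) = tensor_pairing (f \<otimes> f) (\<Sum>k\<in>A. x k \<otimes> x k)"
    by (simp add: linear_sum[OF linear_tensor_pairing_right] tensor_pairing_tensor power2_eq_square)
  also have "\<dots> \<le> conj_norm \<alpha> (f \<otimes> f) * \<alpha> (\<Sum>k\<in>A. x k \<otimes> x k)"
    using tensor_pairing_le_conj_norm[OF assms(1,2)] by (rule order_trans[OF abs_ge_self])
  \<comment> \<open>The cross-norm property of \<open>conj_norm \<alpha>\<close> yields a constant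
    that depends on \<open>norm f\<close> alone, hence the later uniformity in
    \<open>f\<close>.\<close>
  also have "conj_norm \<alpha> (f \<otimes> f) = (norm f)\<^sup>2"
    using assms(3) by (simp add: cross_norm_def power2_eq_square)
  finally show ?thesis .
qed

text \<open>Cauchy--Schwarz against the constant sequence 1, whose squared norm \<open>n\<close>
  cancels one of the two factors \<open>1 / n\<close>. For \<open>n = 0\<close> both sides are
  0.\<close>

lemma mean_abs_le_sqrt_mean_power2:
  fixes a :: "nat \<Rightarrow> real"
  shows "(1 / real n) * (\<Sum>k=1..n. \<bar>a k\<bar>) \<le> sqrt ((1 / real n) * (\<Sum>k=1..n. (a k)\<^sup>2))"
proof (cases "n = 0")
  case False
  have "(\<Sum>k=1..n. \<bar>a k\<bar>)\<^sup>2 \<le> (\<Sum>k=1..n. (a k)\<^sup>2) * real n"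
    using sum_squared_le_sum_of_squares[of "\<lambda>k. \<bar>a k\<bar>" "{1..n}"] by simp
  with False have "((1 / real n) * (\<Sum>k=1..n. \<bar>a k\<bar>))\<^sup>2 \<le> (1 / real n) * (\<Sum>k=1..n. (a k)\<^sup>2)"
    by (simp add: power_divide power2_eq_square field_simps)
  then show ?thesis
    by (rule real_le_rsqrt)
qed simp

theorem proposition2p5:
  fixes \<alpha> :: "('a::banach, 'a) tensor \<Rightarrow> real"
    and \<iota> :: "('a, 'a) tensor \<Rightarrow> 'c::banach"
    and x :: "nat \<Rightarrow> 'a"
  assumes "cross_norm \<alpha>"
    and "conj_norm_finite \<alpha>"
    and "cross_norm (conj_norm \<alpha>)"
    and "is_completion \<alpha> \<iota>"
    and "bounded (x ` {1..})"
    and "ergodic (\<lambda>k. \<iota> (x k \<otimes> x k))"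
  shows "uniformly_weakly_mixing_to_zero x"
proof -
  define e where "e n = (1 / real n) * \<alpha> (\<Sum>k=1..n. x k \<otimes> x k)" for n
  define m where "m n f = (1 / real n) * (\<Sum>k=1..n. \<bar>blinfun_apply f (x k)\<bar>)"
    for n and f :: "'a \<Rightarrow>\<^sub>L real"
  have norm: "is_norm \<alpha>"
    using assms(1) by (simp add: cross_norm_def)
  have \<iota>: "linear \<iota>" "norm (\<iota> u) = \<alpha> u" for u
    using assms(4) by (simp_all add: is_completion_def)
  have nonneg: "0 \<le> \<alpha> u" for u
    using norm_ge_zero[of "\<iota> u"] by (simp only: \<iota>(2))
  \<comment> \<open>Linearity of \<iota> pulls the sum inside, and isometry turns the norm in the
    completion into \<alpha>.\<close>
  have "e \<longlonglongrightarrow> 0"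
    using assms(6) by (simp add: ergodic_def e_def[abs_def] \<iota>(2) flip: linear_sum[OF \<iota>(1)])
  then have lim: "(\<lambda>n. sqrt (e n)) \<longlonglongrightarrow> 0"
    using tendsto_real_sqrt by fastforce
  have m_le: "m n f \<le> sqrt (e n)" if "f \<in> cball 0 1" for n f
  proof -
    have "(norm f)\<^sup>2 \<le> 1"
      using that by (simp add: power_le_one)
    then have "(norm f)\<^sup>2 * \<alpha> (\<Sum>k=1..n. x k \<otimes> x k) \<le> \<alpha> (\<Sum>k=1..n. x k \<otimes> x k)"
      by (rule mult_left_le_one_le[OF nonneg zero_le_power2])
    with sum_power2_le_cross_norm[OF norm assms(2,3), of f x "{1..n}"]
    have "(\<Sum>k=1..n. (blinfun_apply f (x k))\<^sup>2) \<le> \<alpha> (\<Sum>k=1..n. x k \<otimes> x k)"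
      by linarith
    then have "sqrt ((1 / real n) * (\<Sum>k=1..n. (blinfun_apply f (x k))\<^sup>2)) \<le> sqrt (e n)"
      unfolding e_def by (intro real_sqrt_le_mono mult_left_mono) simp_all
    then show ?thesis
      unfolding m_def by (rule order_trans[OF mean_abs_le_sqrt_mean_power2])
  qed
  have upper: "(SUP f\<in>cball 0 1. m n f) \<le> sqrt (e n)" for n
    by (rule cSUP_least) (use m_le in auto)
  have lower: "0 \<le> (SUP f\<in>cball 0 1. m n f)" for n
  proof -
    \<comment> \<open>The zero functional is the witness, as \<open>m n 0 = 0\<close>;
      \<open>m_le\<close> also bounds the set above, as \<open>cSUP_upper\<close> requires.\<close>
    have "m n 0 \<le> (SUP f\<in>cball 0 1. m n f)"
      by (rule cSUP_upper) (use m_le in \<open>auto intro!: bdd_aboveI2\<close>)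
    then show ?thesis
      by (simp add: m_def)
  qed
  have "(\<lambda>n. SUP f\<in>cball 0 1. m n f) \<longlonglongrightarrow> 0"
    by (rule tendsto_sandwich[OF _ _ tendsto_const lim]) (simp_all add: lower upper)
  then show ?thesis
    by (simp add: uniformly_weakly_mixing_to_zero_def m_def)
qed

end
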